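(* Let $r\geq 0$ be an integer. For each real $u\ge 0$, $$u=\sum_{m=r}^{\infty}\sum_{k=r}^{m}\binom{m}{k}\binom{k}{r}\frac{(-1)^{k+r}}{k!}\int_0^{\infty}x^{k-1}e^{-x}\ln(xu+1)\,dx,$$ where the outer series converges to $u$. *)

theory Defs
  imports "HOL-Analysis.Analysis"
begin

text \<open>The integrand is absolutely integrable on \<open>(0, \<infinity>)\<close> for every \<open>k\<close>, including \<open>k = 0\<close>, where
  the singularity of \<open>1 / x\<close> at \<open>0\<close> is cancelled by the logarithm.  Hence no Lebesgue integral of
  the statement takes the default value \<open>0\<close> of a non-integrable function.\<close>

lemma log_gamma_integrable:
  fixes u :: real and k :: nat
  assumes "u \<ge> 0"
  shows "set_integrable lborel {0<..} (\<lambda>x. x powi (int k - 1) * exp (- x) * ln (x * u + 1))"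
proof -
  have 1: "(\<lambda>t. complex_of_real t powr (of_nat (Suc k) - 1) / of_real (exp t))
      absolutely_integrable_on {0<..}"
    using absolutely_integrable_Gamma_integral'[of "of_nat (Suc k)"] by simp
  have "set_integrable lebesgue {0<..} (\<lambda>x::real. u * (x ^ k * exp (- x)))"
  proof (intro set_integrable_mult_right)
    have "set_integrable lebesgue {0<..}
        (\<lambda>t. norm (complex_of_real t powr (of_nat (Suc k) - 1) / of_real (exp t)))"
      using 1 by (rule set_integrable_norm)
    then show "set_integrable lebesgue {0<..} (\<lambda>x::real. x ^ k * exp (- x))"
      by (rule set_integrable_cong[THEN iffD1, rotated -1])
         (auto simp: norm_divide norm_power exp_minus field_simps)
  qed
  then have 2: "set_integrable lborel {0<..} (\<lambda>x::real. u * (x ^ k * exp (- x)))"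
    unfolding set_integrable_def by (subst (asm) integrable_completion) auto
  show ?thesis
  proof (rule set_integrable_bound[OF 2])
    show "set_borel_measurable lborel {0<..}
        (\<lambda>x. x powi (int k - 1) * exp (- x) * ln (x * u + 1))"
    proof -
      have "continuous_on {0<..} (\<lambda>x. x powi (int k - 1) * exp (- x) * ln (x * u + 1))"
        using assms
        by (intro continuous_intros) (auto simp: add_nonneg_eq_0_iff less_imp_le)
      then have "(\<lambda>x. indicat_real {0<..} x *\<^sub>R (x powi (int k - 1) * exp (- x) * ln (x * u + 1)))
          \<in> borel_measurable borel"
        by (intro borel_measurable_continuous_on_indicator) auto
      then show ?thesis
        by (simp add: set_borel_measurable_def)
    qed
    have "norm (x powi (int k - 1) * exp (- x) * ln (x * u + 1)) \<le> norm (u * (x ^ k * exp (- x)))"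
      if "x > 0" for x :: real
    proof -
      have xu: "x * u \<ge> 0" using that assms by simp
      have a: "x powi (int k - 1) * x = x ^ k"
        using that by (simp add: power_int_diff)
      have "x powi (int k - 1) * exp (- x) * ln (x * u + 1)
          \<le> x powi (int k - 1) * exp (- x) * (x * u)"
        using that ln_add_one_self_le_self[OF xu] by (intro mult_left_mono) (auto simp: add.commute)
      also have "\<dots> = u * (x ^ k * exp (- x))"
        unfolding a[symmetric] by (simp add: algebra_simps)
      finally show ?thesis using that assms xu by (simp add: abs_mult)
    qed
    then show "AE x in lborel. x \<in> {0<..} \<longrightarrow>
        norm (x powi (int k - 1) * exp (- x) * ln (x * u + 1)) \<le> norm (u * (x ^ k * exp (- x)))"
      by auto
  qed
qed

end

theory Submission
  imports Defs "HOL-Probability.Distributions"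
begin

text \<open>
  Write \<open>1 / (1 + x t)\<close> as the integral of \<open>exp (- s (1 + x t))\<close> over \<open>s > 0\<close> and \<open>ln (x u + 1) / x\<close> as
  the integral of \<open>1 / (1 + x t)\<close> over \<open>0 \<le> t \<le> u\<close>. Integrating over \<open>x\<close> first, Tonelli's theorem
  turns the \<open>k\<close>-th integral divided by \<open>k!\<close> into the moment \<open>\<integral> w ^ (k + 1)\<close> of
  \<open>w (t, s) = 1 / (1 + s t) \<in> (0, 1]\<close> with respect to the measure \<open>exp (- s) ds dt\<close> of total mass \<open>u\<close>.
  The inner sum for \<open>m = n + r\<close> becomes the integral of \<open>(n + r choose r) w ^ (r + 1) (1 - w) ^ n\<close>.
  These functions are nonnegative and sum to \<open>1\<close> over \<open>n\<close>, by the negative binomial series, so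
  that the series converges to the total mass \<open>u\<close>.
\<close>

section \<open>Binomial identities and the series of moments\<close>

lemma negative_binomial_sums:
  fixes w :: real
  assumes "0 < w" "w \<le> 1"
  shows "(\<lambda>n. real ((n + r) choose r) * w ^ Suc r * (1 - w) ^ n) sums 1"
proof -
  \<comment> \<open>Newton's binomial series of (1 + z) powr (- (r + 1)) at z = w - 1; it converges
    because 0 < w \<le> 1 gives |z| < 1.\<close>
  have "(\<lambda>n. (- (real r + 1) gchoose n) * (w - 1) ^ n) sums (1 + (w - 1)) powr (- (real r + 1))"
    using assms by (intro gen_binomial_real) auto
  \<comment> \<open>Negating the upper index produces a factor (-1) ^ n, which cancels the one from
    (w - 1) ^ n.\<close>
  moreover have "(- (real r + 1) gchoose n) * (w - 1) ^ n = real ((n + r) choose r) * (1 - w) ^ n" for n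
  proof -
    have "(- (real r + 1) gchoose n) = (-1) ^ n * real ((n + r) choose n)"
      by (subst gbinomial_minus) (simp add: binomial_gbinomial add_ac)
    moreover have "(n + r) choose n = (n + r) choose r"
      using binomial_symmetric[of n "n + r"] by simp
    moreover have "(w - 1) ^ n = (-1) ^ n * (1 - w) ^ n"
      by (simp flip: power_mult_distrib)
    ultimately show ?thesis
      by (simp flip: power_mult_distrib)
  qed
  moreover have "(1 + (w - 1)) powr (- (real r + 1)) = 1 / w ^ Suc r"
    using assms powr_realpow[of w "Suc r"] powr_minus_divide[of w "real r + 1"] by (simp add: add_ac)
  ultimately have "(\<lambda>n. real ((n + r) choose r) * (1 - w) ^ n) sums (1 / w ^ Suc r)"
    by simp
  from sums_mult[OF this, of "w ^ Suc r"] show ?thesis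
    using assms by (simp add: mult_ac)
qed

text \<open>With k = j + r, trinomial revision turns the product of the two binomials into (n + r
  choose r) (n choose j). The sum over j is then the binomial expansion of (1 - w) ^ n.\<close>

lemma alternating_binomial_sum:
  fixes w :: real
  shows "(\<Sum>k=r..n + r. real ((n + r) choose k) * real (k choose r) * (-1) ^ (k + r) * w ^ Suc k)
    = real ((n + r) choose r) * w ^ Suc r * (1 - w) ^ n"
proof -
  have "(\<Sum>k=r..n + r. real ((n + r) choose k) * real (k choose r) * (-1) ^ (k + r) * w ^ Suc k)
      = (\<Sum>j\<le>n. real ((n + r) choose (j + r)) * real ((j + r) choose r) * (-1) ^ (j + r + r) * w ^ Suc (j + r))"
    by (rule sum.reindex_bij_witness[of _ "\<lambda>j. j + r" "\<lambda>k. k - r"]) auto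
  also have "\<dots> = (\<Sum>j\<le>n. real ((n + r) choose r) * w ^ Suc r * (real (n choose j) * (- w) ^ j))"
  proof (rule sum.cong)
    fix j assume "j \<in> {..n}"
    then have choose: "real ((n + r) choose (j + r)) * real ((j + r) choose r)
        = real ((n + r) choose r) * real (n choose j)"
      using choose_mult[of r "j + r" "n + r"] by (simp flip: of_nat_mult)
    \<comment> \<open>The shift makes the exponent of the sign j + 2 r, so only (-1) ^ j survives,
      and it is absorbed into (- w) ^ j.\<close>
    have sign: "(-1) ^ (j + r + r) * w ^ Suc (j + r) = w ^ Suc r * (- w) ^ j"
    proof -
      have "(-1) ^ (j + r + r) = ((-1) ^ j :: real)"
        by (simp add: add.assoc power_add flip: power_mult_distrib)
      moreover have "(- w) ^ j = (-1) ^ j * w ^ j"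
        by (rule power_minus)
      ultimately show ?thesis
        by (simp add: power_add)
    qed
    have "real ((n + r) choose (j + r)) * real ((j + r) choose r) * (-1) ^ (j + r + r) * w ^ Suc (j + r)
        = (real ((n + r) choose (j + r)) * real ((j + r) choose r)) * ((-1) ^ (j + r + r) * w ^ Suc (j + r))"
      by (simp only: mult.assoc)
    also have "\<dots> = real ((n + r) choose r) * w ^ Suc r * (real (n choose j) * (- w) ^ j)"
      unfolding choose sign by (simp only: mult_ac)
    finally show "real ((n + r) choose (j + r)) * real ((j + r) choose r) * (-1) ^ (j + r + r) * w ^ Suc (j + r)
        = real ((n + r) choose r) * w ^ Suc r * (real (n choose j) * (- w) ^ j)" .
  qed simp
  also have "\<dots> = real ((n + r) choose r) * w ^ Suc r * (1 - w) ^ n"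
    using binomial_ring[of "- w" 1 n] by (simp add: sum_distrib_left)
  finally show ?thesis .
qed

text \<open>By linearity each term is the integral of a nonnegative function \<open>f n\<close>, and
  these functions sum to 1 pointwise. Partial sums therefore stay in [0, 1], and the constant 1,
  integrable over a finite measure, dominates them.\<close>

lemma (in finite_measure) binomial_moments_sums:
  fixes w :: "'a \<Rightarrow> real"
  assumes [measurable]: "w \<in> borel_measurable M" and w: "\<And>x. 0 < w x" "\<And>x. w x \<le> 1"
  shows "(\<lambda>n. \<Sum>k=r..n + r. real ((n + r) choose k) * real (k choose r) * (-1) ^ (k + r)
            * (\<integral>x. w x ^ Suc k \<partial>M)) sums measure M (space M)"
proof -
  define f where "f n x = real ((n + r) choose r) * w x ^ Suc r * (1 - w x) ^ n" for n x
  have f_nonneg: "0 \<le> f n x" for n x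
    using w[of x] by (simp add: f_def)
  have f_sums: "(\<lambda>n. f n x) sums 1" for x
    unfolding f_def using w by (rule negative_binomial_sums)
  have int_w: "integrable M (\<lambda>x. w x ^ Suc k)" for k
    using w by (intro integrable_const_bound[where B = 1])
      (auto simp: abs_of_pos power_le_one less_imp_le simp del: power_Suc)
  have f_eq: "f n x = (\<Sum>k=r..n + r. real ((n + r) choose k) * real (k choose r) * (-1) ^ (k + r) * w x ^ Suc k)"
    for n x
    unfolding f_def by (rule alternating_binomial_sum[symmetric])
  have int_f: "integrable M (f n)" for n
    unfolding f_eq[abs_def] using int_w by (intro Bochner_Integration.integrable_sum integrable_mult_right)
  have "(\<lambda>N. \<integral>x. (\<Sum>n<N. f n x) \<partial>M) \<longlonglongrightarrow> (\<integral>x. 1 \<partial>M)"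
  proof (rule integral_dominated_convergence)
    show "(\<lambda>x. \<Sum>n<N. f n x) \<in> borel_measurable M" for N
      unfolding f_def by measurable
    show "AE x in M. (\<lambda>N. \<Sum>n<N. f n x) \<longlonglongrightarrow> 1"
      using f_sums by (simp add: sums_def)
    show "AE x in M. norm (\<Sum>n<N. f n x) \<le> 1" for N
    proof (rule AE_I2)
      fix x
      have "(\<Sum>n<N. f n x) \<le> (\<Sum>n. f n x)"
        using f_sums f_nonneg by (intro sum_le_suminf) (auto simp: sums_iff)
      then show "norm (\<Sum>n<N. f n x) \<le> 1"
        using f_sums[of x] by (simp add: sums_iff sum_nonneg f_nonneg)
    qed
  qed auto
  then have "(\<lambda>n. \<integral>x. f n x \<partial>M) sums measure M (space M)"
    using int_f by (simp add: sums_def)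
  moreover have "(\<integral>x. f n x \<partial>M) = (\<Sum>k=r..n + r. real ((n + r) choose k) * real (k choose r) * (-1) ^ (k + r)
            * (\<integral>x. w x ^ Suc k \<partial>M))" for n
    unfolding f_eq using int_w
    by (subst Bochner_Integration.integral_sum) (auto simp del: power_Suc)
  ultimately show ?thesis by simp
qed

section \<open>Laplace transforms of Erlang densities\<close>

lemma nn_integral_erlang_density:
  assumes "0 < l"
  shows "(\<integral>\<^sup>+x. ennreal (erlang_density k l x) \<partial>lborel) = 1"
  using prob_space.emeasure_space_1[OF prob_space_erlang_density[OF assms]]
  by (simp add: emeasure_density)

text \<open>Multiplying by exp (- p x) raises the rate from 1 to 1 + p. Up to the factor (1 / (1 +
  p)) ^ (k + 1) the result is again an Erlang density, of total mass 1.\<close>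

lemma nn_integral_erlang_density_times_exp:
  assumes "0 \<le> p"
  shows "(\<integral>\<^sup>+x. ennreal (erlang_density k 1 x) * ennreal (exp (- (p * x))) \<partial>lborel)
    = ennreal ((1 / (1 + p)) ^ Suc k)"
proof -
  have "erlang_density k 1 x * exp (- (p * x)) = (1 / (1 + p)) ^ Suc k * erlang_density k (1 + p) x" for x
  proof -
    have "exp (- x) * exp (- (p * x)) = exp (- (1 + p) * x)"
      by (simp add: algebra_simps flip: exp_add)
    then show ?thesis
      using assms by (simp add: erlang_density_def power_divide)
  qed
  then have "(\<integral>\<^sup>+x. ennreal (erlang_density k 1 x) * ennreal (exp (- (p * x))) \<partial>lborel)
      = (\<integral>\<^sup>+x. ennreal ((1 / (1 + p)) ^ Suc k) * ennreal (erlang_density k (1 + p) x) \<partial>lborel)"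
    using assms by (simp flip: ennreal_mult del: power_Suc)
  also have "\<dots> = ennreal ((1 / (1 + p)) ^ Suc k)"
    using assms by (simp add: nn_integral_cmult nn_integral_erlang_density)
  finally show ?thesis .
qed

section \<open>The measure exp (- s) ds dt and its moments\<close>

definition mixing_measure :: "real \<Rightarrow> (real \<times> real) measure" where
  "mixing_measure u = density lborel (indicator {0..u}) \<Otimes>\<^sub>M density lborel (erlang_density 0 1)"

definition mixing_weight :: "real \<times> real \<Rightarrow> real" where
  "mixing_weight z = 1 / (1 + \<bar>fst z * snd z\<bar>)"
  \<comment> \<open>The absolute value only matters off the support and makes the bounds hold everywhere.\<close>

lemma sets_mixing_measure [measurable_cong]:
  "sets (mixing_measure u) = sets (borel \<Otimes>\<^sub>M borel)"
  unfolding mixing_measure_def by (intro sets_pair_measure_cong) auto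

lemma borel_measurable_mixing_weight [measurable]:
  "mixing_weight \<in> borel_measurable (borel \<Otimes>\<^sub>M borel)"
  unfolding mixing_weight_def by measurable

lemma mixing_weight_pos: "0 < mixing_weight z"
  by (simp add: mixing_weight_def add_pos_nonneg)

lemma mixing_weight_le_1: "mixing_weight z \<le> 1"
  by (simp add: mixing_weight_def)

text \<open>Shape 0 and rate 1 give the exponential density exp (- s) on s \<ge> 0. In Erlang form,
  \<open>nn_integral_erlang_density_times_exp\<close> serves for s as well as for x.\<close>

lemma prob_space_exponential: "prob_space (density lborel (\<lambda>x. ennreal (erlang_density 0 1 x)))"
  by (rule prob_space_erlang_density) simp

lemma nn_integral_mixing_measure:
  assumes [measurable]: "f \<in> borel_measurable (borel \<Otimes>\<^sub>M borel)"
  shows "(\<integral>\<^sup>+z. f z \<partial>mixing_measure u) =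
    (\<integral>\<^sup>+t. (\<integral>\<^sup>+s. ennreal (erlang_density 0 1 s) * f (t, s) \<partial>lborel) * indicator {0..u} t \<partial>lborel)"
proof -
  interpret S: prob_space "density lborel (\<lambda>x. ennreal (erlang_density 0 1 x))"
    by (rule prob_space_exponential)
  have "(\<integral>\<^sup>+z. f z \<partial>mixing_measure u) = (\<integral>\<^sup>+t. (\<integral>\<^sup>+s. f (t, s)
      \<partial>density lborel (\<lambda>x. ennreal (erlang_density 0 1 x))) \<partial>density lborel (indicator {0..u}))"
    unfolding mixing_measure_def
    by (intro S.nn_integral_fst[symmetric]) measurable
  also have "\<dots> = (\<integral>\<^sup>+t. (\<integral>\<^sup>+s. ennreal (erlang_density 0 1 s) * f (t, s) \<partial>lborel)
      * indicator {0..u} t \<partial>lborel)"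
    by (simp add: nn_integral_density mult.commute)
  finally show ?thesis .
qed

lemma emeasure_mixing_measure:
  assumes "0 \<le> u"
  shows "emeasure (mixing_measure u) (space (mixing_measure u)) = ennreal u"
proof -
  have "emeasure (mixing_measure u) (space (mixing_measure u)) = (\<integral>\<^sup>+z. 1 \<partial>mixing_measure u)"
    by simp
  also have "\<dots> = ennreal u"
    using assms by (subst nn_integral_mixing_measure) (simp_all add: nn_integral_erlang_density)
  finally show ?thesis .
qed

lemma finite_measure_mixing_measure: "0 \<le> u \<Longrightarrow> finite_measure (mixing_measure u)"
  by (rule finite_measureI) (simp add: emeasure_mixing_measure)

text \<open>The integral over s is the Laplace transform of the exponential law at x t, namely 1 /
  (1 + x t), whose antiderivative in t is ln (1 + x t) / x.\<close>

lemma nn_integral_mixing_measure_exp: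
  assumes "0 \<le> u" "0 < x"
  shows "(\<integral>\<^sup>+z. ennreal (exp (- (\<bar>fst z * snd z\<bar> * x))) \<partial>mixing_measure u) = ennreal (ln (x * u + 1) / x)"
proof -
  have "(\<integral>\<^sup>+z. ennreal (exp (- (\<bar>fst z * snd z\<bar> * x))) \<partial>mixing_measure u)
      = (\<integral>\<^sup>+t. (\<integral>\<^sup>+s. ennreal (erlang_density 0 1 s) * ennreal (exp (- (\<bar>t * s\<bar> * x))) \<partial>lborel)
          * indicator {0..u} t \<partial>lborel)"
    by (subst nn_integral_mixing_measure) simp_all
  also have "\<dots> = (\<integral>\<^sup>+t. ennreal (1 / (1 + x * t)) * indicator {0..u} t \<partial>lborel)"
  proof (rule nn_integral_cong)
    fix t :: real
    have "(\<integral>\<^sup>+s. ennreal (erlang_density 0 1 s) * ennreal (exp (- (\<bar>t * s\<bar> * x))) \<partial>lborel)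
        = ennreal (1 / (1 + x * t))" if "0 \<le> t"
    proof -
      have "(\<integral>\<^sup>+s. ennreal (erlang_density 0 1 s) * ennreal (exp (- (\<bar>t * s\<bar> * x))) \<partial>lborel)
          = (\<integral>\<^sup>+s. ennreal (erlang_density 0 1 s) * ennreal (exp (- (x * t * s))) \<partial>lborel)"
        using that by (intro nn_integral_cong) (auto simp: erlang_density_def mult_ac)
      also have "\<dots> = ennreal (1 / (1 + x * t))"
        using that assms by (subst nn_integral_erlang_density_times_exp) auto
      finally show ?thesis .
    qed
    then show "(\<integral>\<^sup>+s. ennreal (erlang_density 0 1 s) * ennreal (exp (- (\<bar>t * s\<bar> * x))) \<partial>lborel)
        * indicator {0..u} t = ennreal (1 / (1 + x * t)) * indicator {0..u} t"
      by (auto split: split_indicator)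
  qed
  also have "\<dots> = ennreal (ln (1 + x * u) / x - ln (1 + x * 0) / x)"
  proof (rule nn_integral_FTC_Icc)
    fix t assume "t \<in> {0..u}"
    then have "0 < 1 + x * t"
      using assms by (simp add: add_pos_nonneg)
    then show "((\<lambda>t. ln (1 + x * t) / x) has_real_derivative 1 / (1 + x * t)) (at t)"
      using assms by (auto intro!: derivative_eq_intros)
    show "0 \<le> 1 / (1 + x * t)"
      using \<open>0 < 1 + x * t\<close> by simp
  qed (use assms in auto)
  finally show ?thesis
    by (simp add: add.commute)
qed

text \<open>The Laplace transform at p = |t s| expresses the power of the weight as an integral over
  x. After exchanging the integrals, the inner one is ln (x u + 1) / x, and its denominator lowers
  the power of x from k to k - 1. All integrands are nonnegative, so the exchange takes place in
  \<open>ennreal\<close>.\<close>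

lemma log_gamma_integral_eq_moment:
  assumes "0 \<le> u"
  shows "(LBINT x:{0<..}. x powi (int k - 1) * exp (- x) * ln (x * u + 1)) / fact k
    = (\<integral>z. mixing_weight z ^ Suc k \<partial>mixing_measure u)"
proof -
  interpret N: finite_measure "mixing_measure u"
    using assms by (rule finite_measure_mixing_measure)
  interpret P: pair_sigma_finite lborel "mixing_measure u" ..
  define f where "f x = indicator {0<..} x *\<^sub>R (x powi (int k - 1) * exp (- x) * ln (x * u + 1)) / fact k" for x
  have f_nonneg: "0 \<le> f x" for x
    using assms by (auto simp: f_def split: split_indicator intro!: mult_nonneg_nonneg)
  have f_meas: "f \<in> borel_measurable lborel"
    using log_gamma_integrable[OF assms, of k] unfolding f_def set_integrable_def
    by (intro borel_measurable_divide) auto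
  have "(\<integral>\<^sup>+z. ennreal (mixing_weight z ^ Suc k) \<partial>mixing_measure u)
      = (\<integral>\<^sup>+z. (\<integral>\<^sup>+x. ennreal (erlang_density k 1 x) * ennreal (exp (- (\<bar>fst z * snd z\<bar> * x))) \<partial>lborel)
          \<partial>mixing_measure u)"
    unfolding mixing_weight_def by (subst nn_integral_erlang_density_times_exp) simp_all
  also have "\<dots> = (\<integral>\<^sup>+x. (\<integral>\<^sup>+z. ennreal (erlang_density k 1 x) * ennreal (exp (- (\<bar>fst z * snd z\<bar> * x)))
          \<partial>mixing_measure u) \<partial>lborel)"
    by (rule P.Fubini') measurable
  \<comment> \<open>The integrands may differ at x = 0: for k = 0 the Erlang density there is 1,
    while \<open>f\<close> is 0. Hence the equality is only almost everywhere.\<close>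
  also have "\<dots> = (\<integral>\<^sup>+x. ennreal (f x) \<partial>lborel)"
  proof (rule nn_integral_cong_AE)
    have "(\<integral>\<^sup>+z. ennreal (erlang_density k 1 x) * ennreal (exp (- (\<bar>fst z * snd z\<bar> * x))) \<partial>mixing_measure u)
        = ennreal (f x)" if "x \<noteq> 0" for x
    proof (cases "0 < x")
      case True
      have "(\<integral>\<^sup>+z. ennreal (erlang_density k 1 x) * ennreal (exp (- (\<bar>fst z * snd z\<bar> * x))) \<partial>mixing_measure u)
          = ennreal (erlang_density k 1 x) * ennreal (ln (x * u + 1) / x)"
        using True assms by (simp add: nn_integral_cmult nn_integral_mixing_measure_exp)
      also have "\<dots> = ennreal (erlang_density k 1 x * (ln (x * u + 1) / x))"
        using True assms by (intro ennreal_mult[symmetric]) auto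
      also have "erlang_density k 1 x * (ln (x * u + 1) / x) = f x"
        using True by (simp add: f_def erlang_density_def power_int_diff)
      finally show ?thesis .
    next
      case False
      with that show ?thesis by (simp add: f_def erlang_density_def)
    qed
    then show "AE x in lborel.
        (\<integral>\<^sup>+z. ennreal (erlang_density k 1 x) * ennreal (exp (- (\<bar>fst z * snd z\<bar> * x))) \<partial>mixing_measure u)
          = ennreal (f x)"
      using AE_lborel_singleton[of "0::real"] by (auto elim: eventually_mono)
  qed
  finally have eq: "(\<integral>\<^sup>+z. ennreal (mixing_weight z ^ Suc k) \<partial>mixing_measure u) = (\<integral>\<^sup>+x. ennreal (f x) \<partial>lborel)" .
  have "(LBINT x:{0<..}. x powi (int k - 1) * exp (- x) * ln (x * u + 1)) / fact k = (\<integral>x. f x \<partial>lborel)"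
    by (simp add: set_lebesgue_integral_def f_def)
  also have "\<dots> = enn2real (\<integral>\<^sup>+x. ennreal (f x) \<partial>lborel)"
    using f_meas f_nonneg by (intro integral_eq_nn_integral) auto
  also have "\<dots> = (\<integral>z. mixing_weight z ^ Suc k \<partial>mixing_measure u)"
    unfolding eq[symmetric]
    by (rule integral_eq_nn_integral[symmetric]) (auto simp: less_imp_le[OF mixing_weight_pos])
  finally show ?thesis .
qed

theorem theorem1:
  fixes r :: nat and u :: real
  assumes "u \<ge> 0"
  shows "(\<lambda>n. \<Sum>k=r..n + r. real ((n + r) choose k) * real (k choose r) * ((-1) ^ (k + r) / fact k)
            * (LBINT x:{0<..}. x powi (int k - 1) * exp (- x) * ln (x * u + 1))) sums u"
proof -
  interpret N: finite_measure "mixing_measure u"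
    using assms by (rule finite_measure_mixing_measure)
  \<comment> \<open>The outer index is m = n + r. The limit is the total mass u, and each moment is
    afterwards replaced by its logarithmic integral divided by k!.\<close>
  have "(\<lambda>n. \<Sum>k=r..n + r. real ((n + r) choose k) * real (k choose r) * (-1) ^ (k + r)
      * (\<integral>z. mixing_weight z ^ Suc k \<partial>mixing_measure u)) sums measure (mixing_measure u) (space (mixing_measure u))"
    by (rule N.binomial_moments_sums) (measurable, rule mixing_weight_pos, rule mixing_weight_le_1)
  also have "measure (mixing_measure u) (space (mixing_measure u)) = u"
    using assms by (simp add: measure_def emeasure_mixing_measure)
  finally show ?thesis
    by (simp only: log_gamma_integral_eq_moment[OF assms, symmetric] times_divide_eq_right times_divide_eq_left)
qed

end
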